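(* In $U(sl_3)$, let $$J=\frac{(e_{11}-e_{22})^2+2(e_{11}-e_{22})}{4}+e_{21}e_{12},\qquad \overline J=\frac{(e_{11}-e_{33})^2+2(e_{11}-e_{33})}{4}+e_{31}e_{13},\qquad K=[J,\overline J].$$ Then $K=e_{31}e_{12}e_{23}-e_{32}e_{21}e_{13}$, and $J,\overline J$ satisfy the Racah algebra relations $$[J,K]=2J^2+2\{J,\overline J\}-aJ+b^+,\qquad [K,\overline J]=2\overline J^2+2\{J,\overline J\}-a\overline J+b^-,$$ where $a=h^2+3y^2+C_2$ and $$b^{\pm}=(3y\mp h)\left(\frac{(2-y\mp h)C_2}{4}-\frac{C_3}{3}+\frac{(y-2\pm h)(y+2\pm h)(y\pm h)}{8}\right).$$
   Context: $sl_3$ is the complex Lie algebra of traceless $3\times3$ matrices, $e_{ij}=E_{ij}-\frac{\delta_{ij}}3I$ ($E_{ij}$ matrix units), and $U(sl_3)$ is its universal enveloping algebra. $C_2=\sum_{i,j=1}^3e_{ij}e_{ji}$ and $C_3=\sum_{i,j,k=1}^3e_{ij}e_{jk}e_{ki}$ are the Casimir elements (central in $U(sl_3)$). $h=\frac12(e_{22}-e_{33})$ and $y=\frac16(2e_{11}-e_{22}-e_{33})$. $[A,B]=AB-BA$ and $\{A,B\}=AB+BA$. *)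

theory Defs
  imports "HOL-Analysis.Analysis" "HOL-Library.Poly_Mapping"
begin

section \<open>Complex vector spaces, algebras and Lie algebras\<close>

class scaleC =
  fixes scaleC :: "complex \<Rightarrow> 'a \<Rightarrow> 'a"  (infixr "*\<^sub>C" 75)

class complex_vector_space = ab_group_add + scaleC +
  assumes scaleC_add_right: "c *\<^sub>C (x + y) = c *\<^sub>C x + c *\<^sub>C y"
    and scaleC_add_left: "(c + d) *\<^sub>C x = c *\<^sub>C x + d *\<^sub>C x"
    and scaleC_scaleC: "c *\<^sub>C d *\<^sub>C x = (c * d) *\<^sub>C x"
    and scaleC_one: "1 *\<^sub>C x = x"

class complex_algebra_1 = complex_vector_space + ring_1 +
  assumes mult_scaleC_left: "(c *\<^sub>C x) * y = c *\<^sub>C (x * y)"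
    and mult_scaleC_right: "x * (c *\<^sub>C y) = c *\<^sub>C (x * y)"

class complex_lie_algebra = complex_vector_space +
  fixes lie_bracket :: "'a \<Rightarrow> 'a \<Rightarrow> 'a"
  assumes lie_bracket_add_left: "lie_bracket (x + y) z = lie_bracket x z + lie_bracket y z"
    and lie_bracket_add_right: "lie_bracket x (y + z) = lie_bracket x y + lie_bracket x z"
    and lie_bracket_scaleC_left: "lie_bracket (c *\<^sub>C x) y = c *\<^sub>C lie_bracket x y"
    and lie_bracket_scaleC_right: "lie_bracket x (c *\<^sub>C y) = c *\<^sub>C lie_bracket x y"
    and lie_bracket_self: "lie_bracket x x = 0"
    and lie_jacobi: "lie_bracket x (lie_bracket y z) + lie_bracket y (lie_bracket z x)
                       + lie_bracket z (lie_bracket x y) = 0"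


section \<open>Free associative algebras\<close>

datatype 'a free_mon = Free_Mon (letters: "'a list")

instantiation free_mon :: (type) monoid_add
begin
definition zero_free_mon :: "'a free_mon" where "0 = Free_Mon []"
definition plus_free_mon :: "'a free_mon \<Rightarrow> 'a free_mon \<Rightarrow> 'a free_mon"
  where "u + v = Free_Mon (letters u @ letters v)"
instance by standard (simp_all add: zero_free_mon_def plus_free_mon_def)
end

text \<open>The monoid algebra of the free monoid; \<^theory>\<open>HOL-Library.Poly_Mapping\<close> supplies the
  convolution product, which concatenates words.\<close>

type_synonym 'a free_alg = "'a free_mon \<Rightarrow>\<^sub>0 complex"

definition free_gen :: "'a \<Rightarrow> 'a free_alg"
  where "free_gen x = Poly_Mapping.single (Free_Mon [x]) 1"

definition free_const :: "complex \<Rightarrow> 'a free_alg"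
  where "free_const c = Poly_Mapping.single 0 c"

lemma free_const_add: "free_const (c + d) = free_const c + free_const d"
  by (simp add: free_const_def single_add)

lemma free_const_mult: "free_const (c * d) = free_const c * free_const d"
  by (simp add: free_const_def mult_single)

lemma free_const_one: "free_const 1 = 1"
  by (simp add: free_const_def)

lemma update_eq_add_single:
  "a \<notin> Poly_Mapping.keys p \<Longrightarrow> Poly_Mapping.update a b p = p + Poly_Mapping.single a b"
  by (intro poly_mapping_eqI)
     (auto simp: lookup_update lookup_add lookup_single in_keys_iff when_def)

lemma free_const_commute: "p * free_const c = free_const c * p"
proof (induction p rule: update_induct)
  case const
  then show ?case by simp
next
  case (update p a b)
  have "Poly_Mapping.update a b p = p + Poly_Mapping.single a b"
    using update(1) by (rule update_eq_add_single)
  moreover have "Poly_Mapping.single a b * free_const c = free_const c * Poly_Mapping.single a b"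
    by (simp add: free_const_def mult_single mult.commute)
  ultimately show ?case
    using update(3) by (simp add: distrib_left distrib_right)
qed


section \<open>The universal enveloping algebra\<close>

text \<open>The first two generators of the ideal cut the free algebra on the underlying set of the Lie
  algebra down to its tensor algebra; the third identifies the commutator with the bracket.\<close>

inductive_set uea_ideal :: "('a::complex_lie_algebra) free_alg set" where
  add_gen: "free_gen (x + y) - free_gen x - free_gen y \<in> uea_ideal"
| scaleC_gen: "free_gen (c *\<^sub>C x) - free_const c * free_gen x \<in> uea_ideal"
| bracket_gen:
    "free_gen x * free_gen y - free_gen y * free_gen x - free_gen (lie_bracket x y) \<in> uea_ideal"
| zero: "0 \<in> uea_ideal"
| add: "p \<in> uea_ideal \<Longrightarrow> q \<in> uea_ideal \<Longrightarrow> p + q \<in> uea_ideal"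
| mult_left: "p \<in> uea_ideal \<Longrightarrow> r * p \<in> uea_ideal"
| mult_right: "p \<in> uea_ideal \<Longrightarrow> p * r \<in> uea_ideal"

lemma uea_ideal_uminus: "p \<in> uea_ideal \<Longrightarrow> - p \<in> uea_ideal"
  using uea_ideal.mult_left[of p "- 1"] by simp

lemma uea_ideal_diff: "p \<in> uea_ideal \<Longrightarrow> q \<in> uea_ideal \<Longrightarrow> p - q \<in> uea_ideal"
  using uea_ideal.add[of p "- q"] uea_ideal_uminus[of q] by simp

lemma free_mon_plus_eq_zero_iff: "u + v = (0 :: 'a free_mon) \<longleftrightarrow> u = 0 \<and> v = 0"
  by (cases u; cases v) (simp add: plus_free_mon_def zero_free_mon_def)

lemma lookup_mult_zero:
  fixes p q :: "'a free_alg"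
  shows "Poly_Mapping.lookup (p * q) 0 = Poly_Mapping.lookup p 0 * Poly_Mapping.lookup q 0"
proof (induction p rule: update_induct)
  case const
  then show ?case by simp
next
  case (update p a b)
  have eq: "Poly_Mapping.update a b p = p + Poly_Mapping.single a b"
    using update(1) by (rule update_eq_add_single)
  have "Poly_Mapping.lookup (Poly_Mapping.single a b * q) 0
    = Poly_Mapping.lookup (Poly_Mapping.single a b) 0 * Poly_Mapping.lookup q 0"
  proof (induction q rule: update_induct)
    case const
    then show ?case by simp
  next
    case (update q a' b')
    have eq': "Poly_Mapping.update a' b' q = q + Poly_Mapping.single a' b'"
      using update(1) by (rule update_eq_add_single)
    show ?case using update(3)
      by (simp add: eq' distrib_left lookup_add mult_single lookup_single when_def
          free_mon_plus_eq_zero_iff)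
  qed
  with update(3) show ?case
    by (simp add: eq distrib_right lookup_add)
qed

lemma lookup_free_gen_zero: "Poly_Mapping.lookup (free_gen x) 0 = 0"
  by (simp add: free_gen_def lookup_single zero_free_mon_def)

lemma lookup_uea_ideal_zero: "p \<in> uea_ideal \<Longrightarrow> Poly_Mapping.lookup p 0 = 0"
  by (induction rule: uea_ideal.induct)
     (simp_all add: lookup_add lookup_minus lookup_mult_zero lookup_free_gen_zero)

definition uea_rel :: "('a::complex_lie_algebra) free_alg \<Rightarrow> 'a free_alg \<Rightarrow> bool"
  where "uea_rel p q \<longleftrightarrow> p - q \<in> uea_ideal"

lemma equivp_uea_rel: "equivp uea_rel"
proof (rule equivpI)
  show "reflp uea_rel"
    by (simp add: reflp_def uea_rel_def uea_ideal.zero)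
  show "symp uea_rel"
    using uea_ideal_uminus by (fastforce simp: symp_def uea_rel_def)
  show "transp uea_rel"
    using uea_ideal.add by (fastforce simp: transp_def uea_rel_def)
qed

quotient_type (overloaded) 'a uea = "('a::complex_lie_algebra) free_alg" / uea_rel
  by (rule equivp_uea_rel)

instantiation uea :: (complex_lie_algebra) complex_algebra_1
begin

lift_definition zero_uea :: "'a uea" is 0 .

lift_definition one_uea :: "'a uea" is 1 .

lift_definition plus_uea :: "'a uea \<Rightarrow> 'a uea \<Rightarrow> 'a uea" is "(+)"
  unfolding uea_rel_def by (metis add_diff_add uea_ideal.add)

lift_definition minus_uea :: "'a uea \<Rightarrow> 'a uea \<Rightarrow> 'a uea" is "(-)"
  unfolding uea_rel_def
proof -
  fix p p' q q' :: "'a free_alg"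
  assume "p - p' \<in> uea_ideal" "q - q' \<in> uea_ideal"
  then have "(p - p') - (q - q') \<in> uea_ideal" by (rule uea_ideal_diff)
  then show "p - q - (p' - q') \<in> uea_ideal" by (simp add: algebra_simps)
qed

lift_definition uminus_uea :: "'a uea \<Rightarrow> 'a uea" is uminus
  unfolding uea_rel_def using uea_ideal_uminus by fastforce

lift_definition times_uea :: "'a uea \<Rightarrow> 'a uea \<Rightarrow> 'a uea" is "(*)"
  unfolding uea_rel_def
proof -
  fix p p' q q' :: "'a free_alg"
  assume "p - p' \<in> uea_ideal" "q - q' \<in> uea_ideal"
  then have "(p - p') * q + p' * (q - q') \<in> uea_ideal"
    by (intro uea_ideal.intros)
  then show "p * q - p' * q' \<in> uea_ideal" by (simp add: algebra_simps)
qed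

lift_definition scaleC_uea :: "complex \<Rightarrow> 'a uea \<Rightarrow> 'a uea" is "\<lambda>c p. free_const c * p"
  unfolding uea_rel_def by (metis right_diff_distrib uea_ideal.mult_left)

instance
proof
  fix x y z :: "'a uea" and c d :: complex
  note rel = equivp_reflp[OF equivp_uea_rel]
  have relI: "uea_rel p q" if "p = q" for p q :: "'a free_alg"
    using that rel by simp
  show "x + y + z = x + (y + z)" by transfer (rule relI, simp add: algebra_simps)
  show "x + y = y + x" by transfer (rule relI, simp add: algebra_simps)
  show "0 + x = x" by transfer (rule relI, simp)
  show "- x + x = 0" by transfer (rule relI, simp)
  show "x - y = x + - y" by transfer (rule relI, simp)
  show "x * y * z = x * (y * z)" by transfer (rule relI, simp add: algebra_simps)
  show "1 * x = x" by transfer (rule relI, simp)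
  show "x * 1 = x" by transfer (rule relI, simp)
  show "(x + y) * z = x * z + y * z" by transfer (rule relI, simp add: algebra_simps)
  show "x * (y + z) = x * y + x * z" by transfer (rule relI, simp add: algebra_simps)
  show "(0 :: 'a uea) \<noteq> 1"
    by transfer (auto simp: uea_rel_def lookup_minus dest: lookup_uea_ideal_zero)
  show "c *\<^sub>C (x + y) = c *\<^sub>C x + c *\<^sub>C y" by transfer (rule relI, simp add: distrib_left)
  show "(c + d) *\<^sub>C x = c *\<^sub>C x + d *\<^sub>C x"
    by transfer (rule relI, simp add: free_const_add distrib_right)
  show "c *\<^sub>C d *\<^sub>C x = (c * d) *\<^sub>C x"
    by transfer (rule relI, simp add: free_const_mult mult.assoc)
  show "1 *\<^sub>C x = x" by transfer (rule relI, simp add: free_const_one)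
  show "(c *\<^sub>C x) * y = c *\<^sub>C (x * y)" by transfer (rule relI, simp add: mult.assoc)
  show "x * (c *\<^sub>C y) = c *\<^sub>C (x * y)"
    by transfer (rule relI, metis free_const_commute mult.assoc)
qed

end

lift_definition uea_of :: "'a::complex_lie_algebra \<Rightarrow> 'a uea" is free_gen .

lemma uea_of_add: "uea_of (x + y) = uea_of x + uea_of y"
  using uea_ideal.add_gen[of x y] by transfer (simp add: uea_rel_def diff_diff_eq)

lemma uea_of_scaleC: "uea_of (c *\<^sub>C x) = c *\<^sub>C uea_of x"
  using uea_ideal.scaleC_gen[of c x] by transfer (simp add: uea_rel_def)

lemma uea_of_bracket: "uea_of (lie_bracket x y) = uea_of x * uea_of y - uea_of y * uea_of x"
  using uea_ideal_uminus[OF uea_ideal.bracket_gen[of x y]] by transfer (simp add: uea_rel_def)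


section \<open>The Lie algebra \<open>sl\<^sub>3\<close>\<close>

lemma matrix_distrib:
  fixes A B C :: "complex^3^3"
  shows "A ** (B + C) = A ** B + A ** C" "(A + B) ** C = A ** C + B ** C"
    and "A ** (B - C) = A ** B - A ** C" "(A - B) ** C = A ** C - B ** C"
  by (simp_all add: vec_eq_iff matrix_matrix_mult_def distrib_left distrib_right
      left_diff_distrib right_diff_distrib sum.distrib sum_subtractf)

typedef sl3 = "{A :: complex^3^3. trace A = 0}"
  by (rule exI[of _ 0]) (simp add: trace_def)

setup_lifting type_definition_sl3

instantiation sl3 :: complex_lie_algebra
begin

lift_definition zero_sl3 :: sl3 is 0 by (simp add: trace_def)

lift_definition plus_sl3 :: "sl3 \<Rightarrow> sl3 \<Rightarrow> sl3" is "(+)" by (simp add: trace_add)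

lift_definition minus_sl3 :: "sl3 \<Rightarrow> sl3 \<Rightarrow> sl3" is "(-)" by (simp add: trace_sub)

lift_definition uminus_sl3 :: "sl3 \<Rightarrow> sl3" is uminus by (simp add: trace_def sum_negf)

lift_definition scaleC_sl3 :: "complex \<Rightarrow> sl3 \<Rightarrow> sl3" is "\<lambda>c A. \<chi> i j. c * A $ i $ j"
  by (simp add: trace_def sum_distrib_left[symmetric])

lift_definition lie_bracket_sl3 :: "sl3 \<Rightarrow> sl3 \<Rightarrow> sl3" is "\<lambda>A B. A ** B - B ** A"
proof -
  fix A B :: "complex^3^3"
  show "trace (A ** B - B ** A) = 0"
    by (simp only: trace_sub trace_mul_sym[of A B] diff_self)
qed

instance
proof
  fix x y z :: sl3 and c d :: complex
  note mat = matrix_distrib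
  show "x + y + z = x + (y + z)" "x + y = y + x" "0 + x = x" "- x + x = 0" "x - y = x + - y"
    by (transfer, simp)+
  show "c *\<^sub>C (x + y) = c *\<^sub>C x + c *\<^sub>C y" "(c + d) *\<^sub>C x = c *\<^sub>C x + d *\<^sub>C x"
    "c *\<^sub>C d *\<^sub>C x = (c * d) *\<^sub>C x" "1 *\<^sub>C x = x"
    by (transfer, simp add: vec_eq_iff algebra_simps)+
  show "lie_bracket (x + y) z = lie_bracket x z + lie_bracket y z"
    "lie_bracket x (y + z) = lie_bracket x y + lie_bracket x z"
    by (transfer, simp add: mat)+
  show "lie_bracket (c *\<^sub>C x) y = c *\<^sub>C lie_bracket x y"
    "lie_bracket x (c *\<^sub>C y) = c *\<^sub>C lie_bracket x y"
    by (transfer, simp add: vec_eq_iff matrix_matrix_mult_def sum_3 algebra_simps)+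
  show "lie_bracket x x = 0"
    by transfer simp
  show "lie_bracket x (lie_bracket y z) + lie_bracket y (lie_bracket z x)
      + lie_bracket z (lie_bracket x y) = 0"
    by transfer (simp add: mat matrix_mul_assoc)
qed

end

text \<open>Indices live in the three-element type \<open>3\<close>; its element \<open>3\<close> is the same as \<open>0\<close>.\<close>

lift_definition sl3_e :: "3 \<Rightarrow> 3 \<Rightarrow> sl3"
  is "\<lambda>i j. \<chi> k l. (if k = i \<and> l = j then 1 else 0) - (if i = j \<and> k = l then 1 / 3 else 0)"
proof -
  fix i j :: 3
  show "trace (\<chi> k l. (if k = i \<and> l = j then 1 else 0)
          - (if i = j \<and> k = l then 1 / 3 else 0) :: complex^3^3) = 0"
  proof (cases "i = j")
    case True
    then show ?thesis by (simp add: trace_def sum_subtractf)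
  next
    case False
    then show ?thesis by (auto simp: trace_def intro!: sum.neutral)
  qed
qed


section \<open>Elements of \<open>U(sl\<^sub>3)\<close>\<close>

definition e :: "3 \<Rightarrow> 3 \<Rightarrow> sl3 uea"
  where "e i j = uea_of (sl3_e i j)"

definition C2 :: "sl3 uea"
  where "C2 = (\<Sum>i\<in>UNIV. \<Sum>j\<in>UNIV. e i j * e j i)"

definition C3 :: "sl3 uea"
  where "C3 = (\<Sum>i\<in>UNIV. \<Sum>j\<in>UNIV. \<Sum>k\<in>UNIV. e i j * e j k * e k i)"

definition commutator :: "'a::ring \<Rightarrow> 'a \<Rightarrow> 'a"
  where "commutator A B = A * B - B * A"

definition anticommutator :: "'a::ring \<Rightarrow> 'a \<Rightarrow> 'a"
  where "anticommutator A B = A * B + B * A"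

end

theory Submission
  imports Defs
begin

text \<open>Put \<open>A = e\<^sub>2\<^sub>1 e\<^sub>1\<^sub>2\<close>, \<open>B = e\<^sub>3\<^sub>1 e\<^sub>1\<^sub>3\<close>, \<open>C = e\<^sub>3\<^sub>2 e\<^sub>2\<^sub>3\<close>, \<open>P = e\<^sub>3\<^sub>1 e\<^sub>1\<^sub>2 e\<^sub>2\<^sub>3\<close> and \<open>Q = e\<^sub>3\<^sub>2 e\<^sub>2\<^sub>1 e\<^sub>1\<^sub>3\<close>.
  These words have weight zero, hence commute with the Cartan elements \<open>e\<^sub>i\<^sub>i\<close>.  Therefore
  \<open>K = [A, B] = P - Q\<close> and \<open>[J, K] = [A, P - Q]\<close>, and the latter is an expression in
  \<open>A\<close>, \<open>B\<close>, \<open>C\<close>, \<open>P + Q\<close> and the Cartan elements.  Since \<open>C\<^sub>2\<close> and \<open>C\<^sub>3\<close> express \<open>C\<close> and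
  \<open>P + Q\<close> through the others, this gives the first relation.  Exchanging the indices 2 and 3
  exchanges \<open>J\<close> with its conjugate, negates \<open>h\<close> and fixes \<open>y\<close>, which gives the second.\<close>

global_interpretation scaleC: vector_space "scaleC :: complex \<Rightarrow> 'a::complex_vector_space \<Rightarrow> 'a"
  by standard (simp_all add: scaleC_add_right scaleC_add_left scaleC_scaleC scaleC_one)

definition functional :: "('a::complex_vector_space \<Rightarrow> complex) \<Rightarrow> bool"
  where "functional \<phi> \<longleftrightarrow> (\<forall>x y. \<phi> (x + y) = \<phi> x + \<phi> y) \<and> (\<forall>c x. \<phi> (c *\<^sub>C x) = c * \<phi> x)"

lemma functional_simps:
  assumes "functional \<phi>"
  shows "\<phi> (x + y) = \<phi> x + \<phi> y" "\<phi> (c *\<^sub>C x) = c * \<phi> x"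
    and "\<phi> (x - y) = \<phi> x - \<phi> y" "\<phi> (- x) = - \<phi> x" "\<phi> 0 = 0"
proof -
  show add: "\<phi> (x + y) = \<phi> x + \<phi> y" for x y
    using assms by (simp add: functional_def)
  show "\<phi> (c *\<^sub>C x) = c * \<phi> x"
    using assms by (simp add: functional_def)
  show zero: "\<phi> 0 = 0"
    using add[of 0 0] by simp
  show "\<phi> (x - y) = \<phi> x - \<phi> y"
    using add[of "x - y" y] by simp
  show "\<phi> (- x) = - \<phi> x"
    using add[of x "- x"] zero by (simp add: eq_neg_iff_add_eq_0 add.commute)
qed

text \<open>Linear functionals separate points.  They turn a linear identity between noncommutative
  monomials into an identity of complex numbers, where like terms can be collected.\<close>

lemma eq_by_functionals:
  fixes x y :: "'a::complex_vector_space"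
  assumes "\<And>\<phi>. functional \<phi> \<Longrightarrow> \<phi> x = \<phi> y"
  shows "x = y"
proof (rule ccontr)
  assume "x \<noteq> y"
  interpret vs: vector_space_pair "scaleC :: complex \<Rightarrow> 'a \<Rightarrow> 'a" "(*) :: complex \<Rightarrow> _"
    by standard (simp_all add: algebra_simps)
  \<comment> \<open>A nonzero vector extends to a basis, so some functional takes the value 1 on
    it.\<close>
  have "scaleC.independent {x - y}"
    using \<open>x \<noteq> y\<close> by (simp add: scaleC.dependent_single)
  then obtain \<phi> where \<phi>: "Vector_Spaces.linear scaleC (*) \<phi>" "\<phi> (x - y) = 1"
    using vs.linear_independent_extend[of "{x - y}" "\<lambda>_. 1"] by auto
  then have "functional \<phi>"
    by (simp add: functional_def vs.linear_add vs.linear_scale)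
  with assms[of \<phi>] \<phi>(2) show False
    by (simp add: functional_simps)
qed

lemma numeral_eq_scaleC: "numeral n = (numeral n *\<^sub>C 1 :: 'a::complex_algebra_1)"
proof -
  have "of_nat k = (of_nat k *\<^sub>C 1 :: 'a)" for k
    by (induction k) (simp_all add: scaleC_add_left scaleC_one)
  from this[of "numeral n"] show ?thesis by simp
qed

text \<open>Lets a rule for \<open>a * b\<close> fire inside a longer word;
  \<open>mult.assoc\<close> nests words to the right.\<close>

lemma mult_eq_assoc: "a * b = c \<Longrightarrow> a * (b * z) = c * (z :: 'a::semigroup_mult)"
  by (metis mult.assoc)

lemmas expand_simps = distrib_left distrib_right left_diff_distrib right_diff_distrib
  mult.assoc power2_eq_square numeral_eq_scaleC mult_scaleC_left mult_scaleC_right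
  scaleC.scale_right_diff_distrib scaleC_add_right

text \<open>The multiples of the identity in \<open>sl3_e\<close> vanish in the bracket and cancel
  in the diagonal difference on the right, leaving the rule for matrix units.\<close>

lemma lie_bracket_sl3_e:
  "lie_bracket (sl3_e i j) (sl3_e k l)
     = (if j = k then sl3_e i l else 0) - (if l = i then sl3_e k j else 0)"
  apply (transfer fixing: i j k l)
  using exhaust_3[of i] exhaust_3[of j] exhaust_3[of k] exhaust_3[of l]
  apply (elim disjE; simp add: vec_eq_iff forall_3 matrix_matrix_mult_def sum_3)
  done

lemma uea_of_0: "uea_of 0 = 0"
  using uea_of_add[of 0 0] by simp

lemma uea_of_minus: "uea_of (x - y) = uea_of x - uea_of y"
  using uea_of_add[of "x - y" y] by simp

lemma e_swap:
  "e i j * e k l = e k l * e i j + (if j = k then e i l else 0) - (if l = i then e k j else 0)"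
  using uea_of_bracket[of "sl3_e i j" "sl3_e k l"]
  by (auto simp: e_def lie_bracket_sl3_e uea_of_0 uea_of_minus algebra_simps split: if_splits)

lemma sum_univ_3:
  fixes f :: "3 \<Rightarrow> 'a::comm_monoid_add"
  assumes "distinct [i, j, k :: 3]"
  shows "(\<Sum>p\<in>UNIV. f p) = f i + f j + f k"
proof -
  have "card {i, j, k} = card (UNIV :: 3 set)"
    using assms by simp
  then have "UNIV = {i, j, k}"
    by (metis card_subset_eq finite_class.finite_UNIV subset_UNIV)
  then have "(\<Sum>p\<in>UNIV. f p) = (\<Sum>p\<in>{i, j, k}. f p)"
    by simp
  then show ?thesis
    using assms by (simp add: add.assoc)
qed

lemma e_trace:
  assumes "distinct [i, j, k]"
  shows "e k k = - e i i - e j j"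
proof -
  have "sl3_e 1 1 + sl3_e 2 2 + sl3_e 3 3 = 0"
    by transfer (simp add: vec_eq_iff forall_3)
  then have "e 1 1 + e 2 2 + e 3 3 = 0"
    by (metis e_def uea_of_add uea_of_0)
  then have "e i i + e j j + e k k = 0"
    using sum_univ_3[OF assms, of "\<lambda>p. e p p"] by (simp add: sum_3)
  then show ?thesis
    by (simp add: algebra_simps eq_neg_iff_add_eq_0)
qed


context
  fixes i j k :: 3
  assumes distinct: "distinct [i, j, k]"
begin

text \<open>Rewriting with these instances sorts a word of \<open>U(sl\<^sub>3)\<close> into the order
  \<open>e\<^sub>i\<^sub>i < e\<^sub>j\<^sub>j < e\<^sub>k\<^sub>i < e\<^sub>k\<^sub>j < e\<^sub>j\<^sub>i < e\<^sub>i\<^sub>j < e\<^sub>i\<^sub>k < e\<^sub>j\<^sub>k\<close> of a PBW basis.\<close>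

lemmas pbw_swaps =
  e_swap[of j j i i] e_swap[of k i i i] e_swap[of k j i i] e_swap[of j i i i] e_swap[of i j i i]
  e_swap[of i k i i] e_swap[of j k i i] e_swap[of k i j j] e_swap[of k j j j] e_swap[of j i j j]
  e_swap[of i j j j] e_swap[of i k j j] e_swap[of j k j j] e_swap[of k j k i] e_swap[of j i k i]
  e_swap[of i j k i] e_swap[of i k k i] e_swap[of j k k i] e_swap[of j i k j] e_swap[of i j k j]
  e_swap[of i k k j] e_swap[of j k k j] e_swap[of i j j i] e_swap[of i k j i] e_swap[of j k j i]
  e_swap[of i k i j] e_swap[of j k i j] e_swap[of j k i k]

lemmas pbw_simps = pbw_swaps pbw_swaps[THEN mult_eq_assoc] e_trace[OF distinct] expand_simps

lemma distinct_simps: "i \<noteq> j" "j \<noteq> i" "i \<noteq> k" "k \<noteq> i" "j \<noteq> k" "k \<noteq> j"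
  using distinct by auto

lemma e_commutator:
  "commutator (e j i * e i j) (e k i * e i k)
     = e k i * e i j * e j k - e k j * e j i * e i k"
  by (rule eq_by_functionals)
     (simp add: commutator_def pbw_simps distinct_simps functional_simps)

text \<open>On the right the cubic words occur only through their sum, which \<open>C3_eq\<close>
  eliminates.\<close>

lemma e_double_commutator:
  "commutator (e j i * e i j) (e k i * e i j * e j k - e k j * e j i * e i k)
     = 2 * (e j i * e i j) * (e k i * e i k) - 2 * (e k j * e j k) * (e j i * e i j)
       - (e i i - e j j) * (e k i * e i j * e j k + e k j * e j i * e i k - 2 * (e k i * e i k))"
  by (rule eq_by_functionals)
     (simp add: commutator_def pbw_simps distinct_simps functional_simps)

text \<open>Moving raising factors to the right leaves \<open>e i i - e j j\<close>,
  \<open>e i i - e k k\<close> and \<open>e j j - e k k\<close>, whose sum is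
  \<open>4 * e i i + 2 * e j j\<close> by tracelessness.\<close>

lemma C2_eq:
  "C2 = 2 * (e j i * e i j) + 2 * (e k i * e i k) + 2 * (e k j * e j k)
        + 2 * (e i i)^2 + 2 * (e j j)^2 + 2 * (e i i * e j j) + 4 * e i i + 2 * e j j"
  by (rule eq_by_functionals)
     (simp add: C2_def sum_univ_3[OF distinct] pbw_simps distinct_simps functional_simps)

lemma C3_eq:
  "C3 = 3 * (e k i * e i j * e j k + e k j * e j i * e i k)
        + 3 * (e i i + e j j + 2) * (e j i * e i j) - 3 * e j j * (e k i * e i k)
        - 3 * e i i * (e k j * e j k)
        + 3 * (e i i)^2 + 6 * e i i - 3 * e i i * e j j * (1 + e i i + e j j)"
  by (rule eq_by_functionals)
     (simp add: C3_def sum_univ_3[OF distinct] pbw_simps distinct_simps functional_simps)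

lemma Cartan_commutes:
  "e j i * e i j * e i i = e i i * (e j i * e i j)"
  "e j i * e i j * e j j = e j j * (e j i * e i j)"
  "e k i * e i k * e i i = e i i * (e k i * e i k)"
  "e k i * e i k * e j j = e j j * (e k i * e i k)"
  "e k j * e j k * e i i = e i i * (e k j * e j k)"
  "e k j * e j k * e j j = e j j * (e k j * e j k)"
  "(e k i * e i j * e j k - e k j * e j i * e i k) * e i i
    = e i i * (e k i * e i j * e j k - e k j * e j i * e i k)"
  "(e k i * e i j * e j k - e k j * e j i * e i k) * e j j
    = e j j * (e k i * e i j * e j k - e k j * e j i * e i k)"
  by (rule eq_by_functionals,
      simp add: pbw_simps distinct_simps functional_simps)+

lemma Racah_commutator:
  assumes J: "J = (1/4) *\<^sub>C ((e i i - e j j)^2 + 2 * (e i i - e j j)) + e j i * e i j"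
    and Jbar: "Jbar = (1/4) *\<^sub>C ((e i i - e k k)^2 + 2 * (e i i - e k k)) + e k i * e i k"
  shows "commutator J Jbar = e k i * e i j * e j k - e k j * e j i * e i k"
proof -
  define A B where "A = e j i * e i j" and "B = e k i * e i k"
  note folds = A_def[symmetric] B_def[symmetric]
  note comm = Cartan_commutes[unfolded folds] e_swap[of j j i i, simplified distinct_simps]
  \<comment> \<open>The Cartan summands commute with each other and with \<open>A\<close> and
    \<open>B\<close>, so they drop out.\<close>
  have "commutator J Jbar = commutator A B"
    by (rule eq_by_functionals)
       (simp add: J Jbar folds commutator_def comm comm[THEN mult_eq_assoc] e_trace[OF distinct]
          distinct_simps expand_simps functional_simps)
  then show ?thesis
    by (simp add: A_def B_def e_commutator)
qed

lemma Racah_relation: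
  assumes J: "J = (1/4) *\<^sub>C ((e i i - e j j)^2 + 2 * (e i i - e j j)) + e j i * e i j"
    and Jbar: "Jbar = (1/4) *\<^sub>C ((e i i - e k k)^2 + 2 * (e i i - e k k)) + e k i * e i k"
    and h: "h = (1/2) *\<^sub>C (e j j - e k k)"
    and y: "y = (1/6) *\<^sub>C (2 * e i i - e j j - e k k)"
  shows "commutator J (commutator J Jbar)
    = 2 * J^2 + 2 * anticommutator J Jbar - (h^2 + 3 * y^2 + C2) * J
      + (3 * y - h) *
           ((1/4) *\<^sub>C ((2 - y - h) * C2) - (1/3) *\<^sub>C C3
            + (1/8) *\<^sub>C ((y - 2 + h) * (y + 2 + h) * (y + h)))"
    (is "_ = ?rhs")
proof -
  \<comment> \<open>These become atoms: the final check uses only their exchange rules, without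
    expanding to PBW words.\<close>
  define u v where "u = e i i" and "v = e j j"
  define A B C where "A = e j i * e i j" and "B = e k i * e i k" and "C = e k j * e j k"
  define K where "K = e k i * e i j * e j k - e k j * e j i * e i k"
  define S where "S = e k i * e i j * e j k + e k j * e j i * e i k"
  note folds = u_def[symmetric] v_def[symmetric] A_def[symmetric] B_def[symmetric] C_def[symmetric]
    K_def[symmetric] S_def[symmetric]
  have AB: "A * B = B * A + K"
    using e_commutator unfolding folds commutator_def by (simp add: algebra_simps)
  \<comment> \<open>The order \<open>C * A\<close> is the one that \<open>C2 * J\<close>
    produces.\<close>
  have AK: "A * K = K * A + 2 * A * B - 2 * C * A - (u - v) * (S - 2 * B)"
    using e_double_commutator unfolding folds commutator_def by (simp add: algebra_simps)
  have vu: "v * u = u * v"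
    using e_swap[of j j i i] by (simp add: u_def v_def distinct_simps)
  note comm = Cartan_commutes[unfolded folds] vu AB AK
  have ekk: "e k k = - u - v"
    using e_trace[OF distinct] by (simp add: u_def v_def)
  have y': "y = (1/2) *\<^sub>C u"
    by (rule eq_by_functionals)
       (simp add: y ekk folds expand_simps functional_simps)
  have h': "h = v + (1/2) *\<^sub>C u"
    by (rule eq_by_functionals)
       (simp add: h ekk folds expand_simps functional_simps algebra_simps)
  have C2': "C2 = 2 * A + 2 * B + 2 * C + 2 * u^2 + 2 * v^2 + 2 * (u * v) + 4 * u + 2 * v"
    using C2_eq unfolding folds .
  have C3': "C3 = 3 * S + 3 * (u + v + 2) * A - 3 * v * B - 3 * u * C
      + 3 * u^2 + 6 * u - 3 * u * v * (1 + u + v)"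
    using C3_eq unfolding folds .
  have "commutator J K = ?rhs"
    by (rule eq_by_functionals)
       (simp add: commutator_def anticommutator_def J Jbar ekk folds y' h' C2' C3'
          comm comm[THEN mult_eq_assoc] expand_simps functional_simps)
  then show ?thesis
    by (simp add: Racah_commutator[OF J Jbar] K_def)
qed

end

theorem mainTheorem4:
  fixes J Jbar K h y a b_plus b_minus :: "sl3 uea"
  assumes "J = (1/4) *\<^sub>C ((e 1 1 - e 2 2)^2 + 2 * (e 1 1 - e 2 2)) + e 2 1 * e 1 2"
    and "Jbar = (1/4) *\<^sub>C ((e 1 1 - e 3 3)^2 + 2 * (e 1 1 - e 3 3)) + e 3 1 * e 1 3"
    and "K = commutator J Jbar"
    and "h = (1/2) *\<^sub>C (e 2 2 - e 3 3)"
    and "y = (1/6) *\<^sub>C (2 * e 1 1 - e 2 2 - e 3 3)"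
    and "a = h^2 + 3 * y^2 + C2"
    and "b_plus = (3 * y - h) *
           ((1/4) *\<^sub>C ((2 - y - h) * C2) - (1/3) *\<^sub>C C3
            + (1/8) *\<^sub>C ((y - 2 + h) * (y + 2 + h) * (y + h)))"
    and "b_minus = (3 * y + h) *
           ((1/4) *\<^sub>C ((2 - y + h) * C2) - (1/3) *\<^sub>C C3
            + (1/8) *\<^sub>C ((y - 2 - h) * (y + 2 - h) * (y - h)))"
  shows "K = e 3 1 * e 1 2 * e 2 3 - e 3 2 * e 2 1 * e 1 3
       \<and> commutator J K = 2 * J^2 + 2 * anticommutator J Jbar - a * J + b_plus
       \<and> commutator K Jbar = 2 * Jbar^2 + 2 * anticommutator J Jbar - a * Jbar + b_minus"
proof (intro conjI)
  have d: "distinct [1, 2, 3 :: 3]" "distinct [1, 3, 2 :: 3]"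
    by simp_all
  show "K = e 3 1 * e 1 2 * e 2 3 - e 3 2 * e 2 1 * e 1 3"
    unfolding assms(3) by (rule Racah_commutator[OF d(1) assms(1,2)])
  show "commutator J K = 2 * J^2 + 2 * anticommutator J Jbar - a * J + b_plus"
    unfolding assms(3,6,7) by (rule Racah_relation[OF d(1) assms(1,2,4,5)])
  have h: "- h = (1/2) *\<^sub>C (e 3 3 - e 2 2)"
    unfolding assms(4) by (simp flip: scaleC.scale_minus_right)
  have y: "y = (1/6) *\<^sub>C (2 * e 1 1 - e 3 3 - e 2 2)"
    unfolding assms(5) by (simp add: algebra_simps)
  \<comment> \<open>Both commutators are reversed, so the two signs cancel and the first relation
    applies with 2 and 3 exchanged.\<close>
  have "commutator K Jbar = commutator Jbar (commutator Jbar J)"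
    unfolding assms(3) commutator_def by (simp add: algebra_simps)
  also have "\<dots> = 2 * Jbar^2 + 2 * anticommutator J Jbar - a * Jbar + b_minus"
    using Racah_relation[OF d(2) assms(2,1) h y]
    by (simp add: assms(6,8) anticommutator_def add.commute)
  finally show "commutator K Jbar
    = 2 * Jbar^2 + 2 * anticommutator J Jbar - a * Jbar + b_minus" .
qed

end
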